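(* For every $n\ge 5$ and every integer $l$ with $TCL(G_n)\le l\le TCL(S_n)$, there exists a maximal outerplanar graph of order $n$ with total chord length equal to $l$.
   Context: A maximal outerplanar graph of order $n$ is regarded as a drawing consisting of an $n$-cycle $\mathcal{C}$ together with a triangulation (by non-crossing edges between vertices of $\mathcal{C}$) of the bounded region determined by $\mathcal{C}$. Edges not in $\mathcal{C}$ are chords; the length of a chord is the length of a shortest path in $\mathcal{C}$ between its endpoints; $TCL$ is the sum of the lengths of all chords. The shell graph $S_n$ is obtained from the $n$-cycle with vertices $v_1,\dots,v_n$ in clockwise order by adding the chords $v_1v_3,\dots,v_1v_{n-2}$; its total chord length is $\frac{n^2-9}{4}$ for $n$ odd and $\frac{n^2-8}{4}$ for $n$ even. The greedy graph $G_n$ is constructed as follows: label the vertices of $\mathcal{C}$ as $v_1,\dots,v_n$ clockwise; add a shortest possible chord starting at $v_1$ with final endpoint clockwise after $v_1$; then repeatedly take the final endpoint of the previously added chord as the starting endpoint of a new shortest possible chord whose final endpoint is clockwise from its starting endpoint, until $n-3$ chords have been added ("possible" meaning drawn inside the bounded region, not already an edge, and not crossing previously added chords). Its total chord length is $n(k+2)-3\cdot 2^{k+1}$ when $3\cdot 2^k\le n\le 3\cdot 2^{k+1}$. *)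

theory Defs
  imports Main
begin

(* The vertices of the n-cycle are 0, ..., n - 1 in clockwise order (v_i is i - 1);
   edges are two-element sets of vertices. *)

definition cycle_edges :: "nat \<Rightarrow> nat set set" where
  "cycle_edges n = {{i, Suc i mod n} | i. i < n}"

definition all_edges :: "nat \<Rightarrow> nat set set" where
  "all_edges n = {{u, v} | u v. u < n \<and> v < n \<and> u \<noteq> v}"

(* Two edges drawn inside the region bounded by the cycle cross iff their four endpoints
   are distinct and alternate around the cycle. *)

definition crosses :: "nat set \<Rightarrow> nat set \<Rightarrow> bool" where
  "crosses e f \<longleftrightarrow> (\<exists>a b c d. a < b \<and> b < c \<and> c < d \<and>
     ((e = {a, c} \<and> f = {b, d}) \<or> (e = {b, d} \<and> f = {a, c})))"

definition outerplane :: "nat \<Rightarrow> nat set set \<Rightarrow> bool" where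
  "outerplane n E \<longleftrightarrow> cycle_edges n \<subseteq> E \<and> E \<subseteq> all_edges n \<and>
     (\<forall>e\<in>E. \<forall>f\<in>E. \<not> crosses e f)"

(* The cycle together with a maximal set of pairwise non-crossing chords,
   i.e. with a triangulation of the bounded region. *)

definition maximal_outerplanar :: "nat \<Rightarrow> nat set set \<Rightarrow> bool" where
  "maximal_outerplanar n E \<longleftrightarrow> outerplane n E \<and>
     (\<forall>E'. outerplane n E' \<and> E \<subseteq> E' \<longrightarrow> E' = E)"

definition cycle_adj :: "nat \<Rightarrow> (nat \<times> nat) set" where
  "cycle_adj n = {(u, v). {u, v} \<in> cycle_edges n}"

(* A shortest walk in the cycle is a shortest path. *)

definition cycle_dist :: "nat \<Rightarrow> nat \<Rightarrow> nat \<Rightarrow> nat" where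
  "cycle_dist n u v = (LEAST k. (u, v) \<in> cycle_adj n ^^ k)"

(* For e = {u, v} the two orderings of the endpoints give the same distance. *)

definition chord_length :: "nat \<Rightarrow> nat set \<Rightarrow> nat" where
  "chord_length n e = (LEAST k. \<exists>u v. e = {u, v} \<and> k = cycle_dist n u v)"

definition TCL :: "nat \<Rightarrow> nat set set \<Rightarrow> nat" where
  "TCL n E = (\<Sum>e\<in>E - cycle_edges n. chord_length n e)"

definition shell_graph :: "nat \<Rightarrow> nat set set" where
  "shell_graph n = cycle_edges n \<union> {{0, j} | j. 2 \<le> j \<and> j \<le> n - 2}"

definition possible_chord :: "nat \<Rightarrow> nat set set \<Rightarrow> nat set \<Rightarrow> bool" where
  "possible_chord n E e \<longleftrightarrow> e \<in> all_edges n \<and> e \<notin> E \<and> (\<forall>f\<in>E. \<not> crosses e f)"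

(* A chord of length d from a has its final endpoint clockwise from a if d clockwise
   steps along the cycle lead from a to that endpoint; so a and d determine the chord. *)

definition greedy_length :: "nat \<Rightarrow> nat set set \<Rightarrow> nat \<Rightarrow> nat" where
  "greedy_length n E a = (LEAST d. possible_chord n E {a, (a + d) mod n} \<and>
     chord_length n {a, (a + d) mod n} = d)"

(* State: starting endpoint of the next chord, and the edges present so far. *)

fun greedy_step :: "nat \<Rightarrow> nat \<times> nat set set \<Rightarrow> nat \<times> nat set set" where
  "greedy_step n (a, E) =
     (let b = (a + greedy_length n E a) mod n in (b, insert {a, b} E))"

definition greedy_graph :: "nat \<Rightarrow> nat set set" where
  "greedy_graph n = snd ((greedy_step n ^^ (n - 3)) (0, cycle_edges n))"

end

theory Submission
  imports Defs
begin

text \<open>A triangle containing the centre of the polygon cuts it into three parts, and on each of them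
  the chords form a binary tree in which a chord has as many leaves below it as its length. So the
  total chord length is the sum of three external path lengths of trees with \<open>a\<close>, \<open>b\<close> and \<open>c\<close>
  leaves, where \<open>a + b + c = n\<close> and \<open>a, b, c \<le> n / 2\<close>. Moving a cherry onto another leaf of the same
  depth increases this sum by exactly one. Such a move exists unless all three trees are
  caterpillars and one of them is a single leaf, and then the sum is the value of the shell graph.
  The greedy construction is Huffman's algorithm on \<open>n\<close> equal weights, so its value is also of
  this form, and every value from there up to that of the shell graph is attained.\<close>

section \<open>External path lengths of binary trees\<close>

text \<open>\<open>ext_path m x\<close>: some binary tree with \<open>m\<close> leaves has external path length \<open>x\<close>,
  counted as the sum over the inner nodes of the number of leaves below.\<close>

inductive ext_path :: "nat \<Rightarrow> nat \<Rightarrow> bool" where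
  leaf: "ext_path 1 0"
| node: "ext_path a x \<Longrightarrow> ext_path b y \<Longrightarrow> ext_path (a + b) (a + b + x + y)"

text \<open>The external path length of a caterpillar: its inner nodes have 2, ..., \<open>m\<close>
  leaves below them.\<close>

definition caterpillar :: "nat \<Rightarrow> nat" where
  "caterpillar m = \<Sum>{2..m}"

lemma caterpillar_1 [simp]: "caterpillar (Suc 0) = 0"
  by (simp add: caterpillar_def)

lemma caterpillar_Suc: "m \<ge> 1 \<Longrightarrow> caterpillar (Suc m) = caterpillar m + Suc m"
  by (simp add: caterpillar_def)

lemma ext_path_pos: "ext_path m x \<Longrightarrow> m \<ge> 1"
  by (induction rule: ext_path.induct) auto

lemma ext_path_caterpillar: "m \<ge> 1 \<Longrightarrow> ext_path m (caterpillar m)"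
proof (induction m rule: nat_induct_at_least)
  case base
  then show ?case using ext_path.leaf by simp
next
  case (Suc m)
  then show ?case
    using ext_path.node[OF Suc.IH ext_path.leaf] by (simp add: caterpillar_Suc add.commute)
qed

text \<open>Replace a leaf of depth \<open>j\<close> in a caterpillar by a cherry.\<close>

lemma ext_path_caterpillar_cherry:
  "1 \<le> j \<Longrightarrow> j < b \<Longrightarrow> ext_path (Suc b) (caterpillar b + j + 2)"
proof (induction j arbitrary: b rule: nat_induct_at_least)
  case base
  then obtain m where b: "b = Suc m" "m \<ge> 1" by (cases b) auto
  have "ext_path 2 2"
    using ext_path.node[OF ext_path.leaf ext_path.leaf] by (simp add: numeral_2_eq_2)
  from ext_path.node[OF ext_path_caterpillar[OF b(2)] this]
  show ?case using b by (simp add: caterpillar_Suc add.commute)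
next
  case (Suc j)
  then obtain m where b: "b = Suc m" "j < m" by (cases b) auto
  \<comment> \<open>A leaf of depth greater than one is replaced inside the big subtree of the root,
    and the root is put back afterwards.\<close>
  have "ext_path (Suc m) (caterpillar m + j + 2)" using Suc.IH b by blast
  from ext_path.node[OF this ext_path.leaf]
  show ?case using b by (simp add: caterpillar_Suc algebra_simps)
qed

text \<open>Moving a cherry of depth \<open>d\<close> onto another leaf of depth \<open>d\<close> increases the external path
  length by one. Here the cherry is the deepest one of a caterpillar with \<open>a\<close> leaves.\<close>

lemma caterpillar_move_cherry:
  assumes "2 \<le> a" "a \<le> b"
  obtains y where "ext_path (a - 1) (caterpillar (a - 1))" "ext_path (Suc b) y"
    "caterpillar (a - 1) + y = Suc (caterpillar a + caterpillar b)"
proof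
  show "ext_path (a - 1) (caterpillar (a - 1))" using assms by (intro ext_path_caterpillar) auto
  \<comment> \<open>In its old place the cherry contributes \<open>a\<close>: two for its own node
    and one for each of its \<open>a - 2\<close> ancestors. Its leaves have depth
    \<open>a - 1\<close>; on a leaf of that depth, which exists since \<open>a - 1 < b\<close>, it
    contributes \<open>a + 1\<close>.\<close>
  show "ext_path (Suc b) (caterpillar b + (a - 1) + 2)"
    using assms by (intro ext_path_caterpillar_cherry) auto
  show "caterpillar (a - 1) + (caterpillar b + (a - 1) + 2) = Suc (caterpillar a + caterpillar b)"
    using assms caterpillar_Suc[of "a - 1"] by simp
qed

text \<open>If a subtree can be raised by one, so can the tree. Otherwise both subtrees are
  caterpillars. If one is a single leaf, the whole tree is a caterpillar; if not, the deepest cherry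
  of the smaller one moves to the larger one.\<close>

lemma ext_path_Suc: "ext_path m x \<Longrightarrow> x = caterpillar m \<or> ext_path m (Suc x)"
proof (induction rule: ext_path.induct)
  case leaf
  then show ?case by simp
next
  case (node a x b y)
  have cat: "a + b + caterpillar a + caterpillar b = caterpillar (a + b) \<or>
      ext_path (a + b) (Suc (a + b + caterpillar a + caterpillar b))"
    if "1 \<le> a" "a \<le> b" for a b
  proof (cases "a = 1")
    case True
    then show ?thesis using that by (simp add: caterpillar_Suc)
  next
    case False
    with that have "2 \<le> a" by simp
    with \<open>a \<le> b\<close> obtain y where y: "ext_path (a - 1) (caterpillar (a - 1))" "ext_path (Suc b) y"
      "caterpillar (a - 1) + y = Suc (caterpillar a + caterpillar b)"
      by (auto elim: caterpillar_move_cherry)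
    have "(a - 1) + Suc b = a + b" using \<open>2 \<le> a\<close> by simp
    with ext_path.node[OF y(1,2)] y(3) show ?thesis by (simp add: add.assoc)
  qed
  show ?case
  proof (cases "x = caterpillar a \<and> y = caterpillar b")
    case True
    show ?thesis
    proof (cases "a \<le> b")
      case True
      then show ?thesis using cat[of a b] ext_path_pos[OF node(1)] \<open>x = _ \<and> _\<close> by simp
    next
      case False
      then show ?thesis using cat[of b a] ext_path_pos[OF node(2)] \<open>x = _ \<and> _\<close>
        by (simp add: add.commute add.left_commute)
    qed
  next
    case False
    then consider "ext_path a (Suc x)" | "ext_path b (Suc y)" using node by blast
    then show ?thesis
    proof cases
      case 1
      from ext_path.node[OF this node(2)] show ?thesis by simp
    next
      case 2
      from ext_path.node[OF node(1) this] show ?thesis by simp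
    qed
  qed
qed

section \<open>Central triangles\<close>

text \<open>The total chord lengths of triangulations whose central triangle cuts off \<open>a\<close>, \<open>b\<close> and \<open>c\<close> sides
  of the polygon.\<close>

definition central :: "nat \<Rightarrow> nat \<Rightarrow> bool" where
  "central n v \<longleftrightarrow> (\<exists>a b c x y z. ext_path a x \<and> ext_path b y \<and> ext_path c z \<and> a + b + c = n \<and>
     2 * a \<le> n \<and> 2 * b \<le> n \<and> 2 * c \<le> n \<and> v = x + y + z)"

lemma centralI:
  assumes "ext_path a x" "ext_path b y" "ext_path c z" "a + b + c = n"
    "2 * a \<le> n" "2 * b \<le> n" "2 * c \<le> n" "v = x + y + z"
  shows "central n v"
  using assms unfolding central_def by blast

text \<open>The value for a central triangle that cuts off \<open>1\<close>,
  \<open>(n - 1) div 2\<close> and \<open>n div 2\<close> sides, with a caterpillar on each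
  part.\<close>

definition shell_value :: "nat \<Rightarrow> nat" where
  "shell_value n = caterpillar (n div 2) + caterpillar ((n - 1) div 2)"

lemma central_caterpillars_Suc:
  assumes "1 \<le> a" "a \<le> b" "b \<le> c" "a + b + c = n" "2 * c \<le> n"
  shows "caterpillar a + caterpillar b + caterpillar c = shell_value n \<or>
    central n (Suc (caterpillar a + caterpillar b + caterpillar c))"
proof (cases "a = 1")
  case True
  \<comment> \<open>The bound \<open>2 * c \<le> n\<close> and \<open>b \<le> c\<close> leave only
    one way to split \<open>n - 1\<close>.\<close>
  then have "c = n div 2" "b = (n - 1) div 2" using assms by linarith+
  then show ?thesis using True by (simp add: shell_value_def)
next
  case False
  then have "2 \<le> a" using assms by simp
  with assms(2) obtain y where y: "ext_path (a - 1) (caterpillar (a - 1))" "ext_path (Suc b) y"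
    "caterpillar (a - 1) + y = Suc (caterpillar a + caterpillar b)"
    by (auto elim: caterpillar_move_cherry)
  \<comment> \<open>Enlarging the middle tree instead of the largest keeps the triangle central:
    \<open>b \<le> c\<close> and \<open>2 \<le> a\<close> give
    \<open>2 * Suc b \<le> n\<close>.\<close>
  have "central n (Suc (caterpillar a + caterpillar b + caterpillar c))"
    by (rule centralI[OF y(1,2) ext_path_caterpillar[of c]])
      (use assms \<open>2 \<le> a\<close> y(3) in auto)
  then show ?thesis ..
qed

text \<open>Raising one tree keeps its number of leaves, hence the triangle. Only when all three
  trees are caterpillars must a cherry pass from one tree to another.\<close>

lemma central_Suc:
  assumes "central n v"
  shows "v = shell_value n \<or> central n (Suc v)"
proof -
  from assms obtain a b c x y z where h: "ext_path a x" "ext_path b y" "ext_path c z"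
    "a + b + c = n" "2 * a \<le> n" "2 * b \<le> n" "2 * c \<le> n" "v = x + y + z"
    unfolding central_def by blast
  show ?thesis
  proof (cases "x = caterpillar a \<and> y = caterpillar b \<and> z = caterpillar c")
    case True
    have pos: "1 \<le> a" "1 \<le> b" "1 \<le> c" using h ext_path_pos by blast+
    consider "a \<le> b" "b \<le> c" | "a \<le> c" "c \<le> b" | "b \<le> a" "a \<le> c" | "b \<le> c" "c \<le> a"
      | "c \<le> a" "a \<le> b" | "c \<le> b" "b \<le> a" by linarith
    then show ?thesis
    proof cases
      case 1
      then show ?thesis using central_caterpillars_Suc[of a b c n] True h pos by (simp add: ac_simps)
    next
      case 2
      then show ?thesis using central_caterpillars_Suc[of a c b n] True h pos by (simp add: ac_simps)
    next
      case 3
      then show ?thesis using central_caterpillars_Suc[of b a c n] True h pos by (simp add: ac_simps)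
    next
      case 4
      then show ?thesis using central_caterpillars_Suc[of b c a n] True h pos by (simp add: ac_simps)
    next
      case 5
      then show ?thesis using central_caterpillars_Suc[of c a b n] True h pos by (simp add: ac_simps)
    next
      case 6
      then show ?thesis using central_caterpillars_Suc[of c b a n] True h pos by (simp add: ac_simps)
    qed
  next
    case False
    then consider "ext_path a (Suc x)" | "ext_path b (Suc y)" | "ext_path c (Suc z)"
      using h ext_path_Suc by blast
    then have "central n (Suc v)"
    proof cases
      case 1
      show ?thesis by (rule centralI[OF 1 h(2,3)]) (use h in auto)
    next
      case 2
      show ?thesis by (rule centralI[OF h(1) 2 h(3)]) (use h in auto)
    next
      case 3
      show ?thesis by (rule centralI[OF h(1,2) 3]) (use h in auto)
    qed
    then show ?thesis ..
  qed
qed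

lemma central_interval:
  assumes "central n u" "u \<le> v" "v \<le> shell_value n"
  shows "central n v"
  using assms(2,3)
proof (induction v rule: dec_induct)
  case base
  show ?case by fact
next
  case (step v)
  then show ?case using central_Suc[of n v] by simp
qed

section \<open>Lengths and crossings of chords\<close>

lemma cycle_adj_iff:
  "(u, v) \<in> cycle_adj n \<longleftrightarrow> (u < n \<and> v = Suc u mod n) \<or> (v < n \<and> u = Suc v mod n)"
  unfolding cycle_adj_def cycle_edges_def by (auto simp: doubleton_eq_iff)

lemma cycle_adj_sym: "sym (cycle_adj n)"
  by (auto simp: sym_def cycle_adj_iff)

lemma cycle_walk_sym: "(u, v) \<in> cycle_adj n ^^ k \<Longrightarrow> (v, u) \<in> cycle_adj n ^^ k"
proof (induction k arbitrary: v)
  case (Suc k)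
  then obtain w where "(u, w) \<in> cycle_adj n ^^ k" "(w, v) \<in> cycle_adj n" by auto
  then have "(w, u) \<in> cycle_adj n ^^ k" "(v, w) \<in> cycle_adj n"
    using Suc.IH cycle_adj_sym[of n] by (auto dest: symD)
  then show ?case by (rule relpow_Suc_I2[rotated])
qed simp

lemma cycle_dist_commute: "cycle_dist n u v = cycle_dist n v u"
proof -
  have "(u, v) \<in> cycle_adj n ^^ k \<longleftrightarrow> (v, u) \<in> cycle_adj n ^^ k" for k
    using cycle_walk_sym by blast
  then show ?thesis by (simp add: cycle_dist_def)
qed

lemma cycle_walk: "n > 0 \<Longrightarrow> (u mod n, (u + k) mod n) \<in> cycle_adj n ^^ k"
proof (induction k)
  case (Suc k)
  have "((u + k) mod n, (u + Suc k) mod n) \<in> cycle_adj n"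
    using Suc.prems by (auto simp: cycle_adj_iff mod_Suc_eq)
  then show ?case using Suc by auto
qed simp

text \<open>For the lower bound on distances: unrolled on the integers, \<open>k\<close> steps move
  by at most \<open>k\<close>, up to full turns.\<close>

lemma cycle_walk_displacement:
  "(u, v) \<in> cycle_adj n ^^ k \<Longrightarrow> \<exists>s. \<bar>s\<bar> \<le> int k \<and> int n dvd int v - int u - s"
proof (induction k arbitrary: v)
  case 0
  then show ?case by (intro exI[of _ 0]) auto
next
  case (Suc k)
  then obtain w where w: "(u, w) \<in> cycle_adj n ^^ k" "(w, v) \<in> cycle_adj n" by auto
  then obtain s where s: "\<bar>s\<bar> \<le> int k" "int n dvd int w - int u - s" using Suc.IH by blast
  have md: "int n dvd int (x mod n) - int x" for x
    by (metis mod_eq_dvd_iff mod_mod_trivial of_nat_mod)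
  from w(2) consider "v = Suc w mod n" | "w = Suc v mod n" by (auto simp: cycle_adj_iff)
  then show ?case
  proof cases
    case 1
    have "int n dvd (int w - int u - s) + (int v - int (Suc w))"
      using s(2) md[of "Suc w"] unfolding 1 by (rule dvd_add)
    then have "int n dvd int v - int u - (s + 1)" by (simp add: algebra_simps)
    then show ?thesis using s(1) by (intro exI[of _ "s + 1"]) auto
  next
    case 2
    have "int n dvd (int w - int u - s) - (int w - int (Suc v))"
      using md[of "Suc v"] s(2) unfolding 2 by (rule dvd_diff[rotated])
    then have "int n dvd int v - int u - (s - 1)" by (simp add: algebra_simps)
    then show ?thesis using s(1) by (intro exI[of _ "s - 1"]) auto
  qed
qed

lemma cycle_dist_eq:
  assumes "u \<le> v" "v < n"
  shows "cycle_dist n u v = min (v - u) (n - (v - u))"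
  unfolding cycle_dist_def
proof (rule Least_equality)
  have 1: "(u, v) \<in> cycle_adj n ^^ (v - u)"
    using cycle_walk[of n u "v - u"] assms by simp
  have "(v, u) \<in> cycle_adj n ^^ (n - (v - u))"
    using cycle_walk[of n v "n - (v - u)"] assms by simp
  then have 2: "(u, v) \<in> cycle_adj n ^^ (n - (v - u))" by (rule cycle_walk_sym)
  show "(u, v) \<in> cycle_adj n ^^ min (v - u) (n - (v - u))"
    unfolding min_def by (split if_split) (blast intro: 1 2)
next
  fix k
  assume "(u, v) \<in> cycle_adj n ^^ k"
  then obtain s where s: "\<bar>s\<bar> \<le> int k" "int n dvd int v - int u - s"
    using cycle_walk_displacement by blast
  then obtain q where q: "int v - int u - s = int n * q" by (auto simp: dvd_def)
  \<comment> \<open>\<open>q\<close> measures full turns. In the first case the displacement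
    \<open>s\<close> is at least \<open>v - u\<close>, in the second it is at least
    \<open>n - (v - u)\<close> in the opposite direction.\<close>
  consider "q \<le> 0" | "q \<ge> 1" by linarith
  then have "int (v - u) \<le> int k \<or> int (n - (v - u)) \<le> int k"
  proof cases
    case 1
    then have "int n * q \<le> 0" by (simp add: mult_nonneg_nonpos)
    then show ?thesis using q s(1) assms by linarith
  next
    case 2
    then have "int n * q \<ge> int n" using mult_left_mono[of 1 q "int n"] by simp
    then show ?thesis using q s(1) assms by linarith
  qed
  then show "min (v - u) (n - (v - u)) \<le> k" by (auto simp: min_def)
qed

lemma chord_length_eq_cycle_dist: "chord_length n {u, v} = cycle_dist n u v"
  unfolding chord_length_def
  by (rule Least_equality) (auto simp: doubleton_eq_iff cycle_dist_commute)

lemma chord_length_eq: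
  "u \<le> v \<Longrightarrow> v < n \<Longrightarrow> chord_length n {u, v} = min (v - u) (n - (v - u))"
  by (simp add: chord_length_eq_cycle_dist cycle_dist_eq)

lemma mod_add_cases:
  fixes a d n :: nat
  assumes "a < n" "d \<le> n"
  shows "(a + d < n \<and> (a + d) mod n = a + d) \<or> (n \<le> a + d \<and> (a + d) mod n = a + d - n)"
  using assms by (cases "a + d < n") (auto simp: le_mod_geq mod_if)

lemma chord_length_clockwise:
  assumes "a < n" "2 * d \<le> n"
  shows "chord_length n {a, (a + d) mod n} = d"
proof -
  from mod_add_cases[of a n d] assms
  consider "a + d < n" "(a + d) mod n = a + d" | "n \<le> a + d" "(a + d) mod n = a + d - n"
    by auto
  then show ?thesis
  proof cases
    case 1
    then show ?thesis using assms by (simp add: chord_length_eq)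
  next
    case 2
    then have "chord_length n {a + d - n, a} = d"
      using assms by (subst chord_length_eq) auto
    then show ?thesis using 2 by (simp add: insert_commute)
  qed
qed

section \<open>Crossing chords and cycle edges\<close>

lemma crosses_iff:
  assumes "p < q" "r < s"
  shows "crosses {p, q} {r, s} \<longleftrightarrow> (p < r \<and> r < q \<and> q < s) \<or> (r < p \<and> p < s \<and> s < q)"
proof
  assume "crosses {p, q} {r, s}"
  then show "(p < r \<and> r < q \<and> q < s) \<or> (r < p \<and> p < s \<and> s < q)"
    using assms unfolding crosses_def by (auto simp: doubleton_eq_iff)
next
  assume "(p < r \<and> r < q \<and> q < s) \<or> (r < p \<and> p < s \<and> s < q)"
  then show "crosses {p, q} {r, s}"
    unfolding crosses_def by blast
qed

lemma cycle_edges_iff: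
  assumes "u < v" "v < n"
  shows "{u, v} \<in> cycle_edges n \<longleftrightarrow> v = Suc u \<or> (u = 0 \<and> v = n - 1)"
proof
  assume "{u, v} \<in> cycle_edges n"
  then obtain i where i: "i < n" "{u, v} = {i, Suc i mod n}" by (auto simp: cycle_edges_def)
  then show "v = Suc u \<or> (u = 0 \<and> v = n - 1)"
    using assms by (cases "Suc i < n") (auto simp: doubleton_eq_iff le_Suc_eq not_less)
next
  assume "v = Suc u \<or> (u = 0 \<and> v = n - 1)"
  then show "{u, v} \<in> cycle_edges n"
  proof
    assume "v = Suc u"
    then show ?thesis using assms by (auto simp: cycle_edges_def intro!: exI[of _ u])
  next
    assume "u = 0 \<and> v = n - 1"
    then show ?thesis using assms
      by (auto simp: cycle_edges_def insert_commute intro!: exI[of _ "n - 1"])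
  qed
qed

lemma cycle_edges_cases:
  assumes "e \<in> cycle_edges n" "n \<ge> 2"
  obtains u where "Suc u < n" "e = {u, Suc u}" | "e = {0, n - 1}"
proof -
  from assms obtain i where i: "i < n" "e = {i, Suc i mod n}" by (auto simp: cycle_edges_def)
  show ?thesis
  proof (cases "Suc i < n")
    case True
    then show ?thesis using i that by auto
  next
    case False
    then have "i = n - 1" "Suc i = n" using i by auto
    then show ?thesis using i that by (auto simp: insert_commute)
  qed
qed

section \<open>Realizing a central value\<close>

text \<open>The rules mirror those of \<open>ext_path\<close>: sides are leaves, and an edge
  \<open>{i, j}\<close> is the inner node whose triangle has its apex at \<open>k\<close>.\<close>

inductive triangulation :: "nat \<Rightarrow> nat \<Rightarrow> nat set set \<Rightarrow> bool" where
  side: "triangulation i (Suc i) {{i, Suc i}}"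
| join: "triangulation i k S \<Longrightarrow> triangulation k j T \<Longrightarrow>
    triangulation i j (insert {i, j} (S \<union> T))"

lemma triangulation_less: "triangulation i j F \<Longrightarrow> i < j"
  by (induction rule: triangulation.induct) auto

lemma triangulation_base: "triangulation i j F \<Longrightarrow> {i, j} \<in> F"
  by (induction rule: triangulation.induct) auto

lemma triangulation_sides: "triangulation i j F \<Longrightarrow> i \<le> p \<Longrightarrow> p < j \<Longrightarrow> {p, Suc p} \<in> F"
proof (induction rule: triangulation.induct)
  case (side i)
  then show ?case by (simp add: le_antisym less_Suc_eq_le)
next
  case (join i k S j T)
  then show ?case by (cases "p < k") auto
qed

lemma triangulation_edges:
  "triangulation i j F \<Longrightarrow> e \<in> F \<Longrightarrow> \<exists>p q. e = {p, q} \<and> i \<le> p \<and> p < q \<and> q \<le> j"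
proof (induction rule: triangulation.induct)
  case (side i)
  then show ?case by auto
next
  case (join i k S j T)
  have "i < k" "k < j" using join.hyps triangulation_less by blast+
  consider "e = {i, j}" | "e \<in> S" | "e \<in> T" using join.prems by auto
  then show ?case
  proof cases
    case 1
    then show ?thesis using \<open>i < k\<close> \<open>k < j\<close>
      by (intro exI[of _ i] exI[of _ j]) auto
  next
    case 2
    then show ?thesis using join.IH(1) \<open>k < j\<close> by (meson le_trans less_imp_le)
  next
    case 3
    then show ?thesis using join.IH(2) \<open>i < k\<close> by (meson le_trans less_imp_le)
  qed
qed

lemma triangulation_finite: "triangulation i j F \<Longrightarrow> finite F"
  by (induction rule: triangulation.induct) auto

lemma triangulation_disjoint:
  assumes "triangulation i k S" "triangulation k j T"
  shows "S \<inter> T = {}" "{i, j} \<notin> S \<union> T"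
proof -
  have "i < k" "k < j" using assms triangulation_less by blast+
  show "S \<inter> T = {}"
  proof (rule ccontr)
    assume "S \<inter> T \<noteq> {}"
    then obtain e where "e \<in> S" "e \<in> T" by blast
    then obtain p q r s where "e = {p, q}" "p < q" "q \<le> k" "e = {r, s}" "k \<le> r" "r < s"
      using triangulation_edges[OF assms(1)] triangulation_edges[OF assms(2)] by meson
    then show False by (auto simp: doubleton_eq_iff)
  qed
  show "{i, j} \<notin> S \<union> T"
    using triangulation_edges[OF assms(1), of "{i, j}"] triangulation_edges[OF assms(2), of "{i, j}"]
      \<open>i < k\<close> \<open>k < j\<close> by (auto simp: doubleton_eq_iff)
qed

text \<open>Edges from different halves are separated by \<open>k\<close>, and no edge between
  vertices from \<open>i\<close> to \<open>j\<close> crosses the base.\<close>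

lemma triangulation_not_crosses:
  "triangulation i j F \<Longrightarrow> e \<in> F \<Longrightarrow> f \<in> F \<Longrightarrow> \<not> crosses e f"
proof (induction rule: triangulation.induct)
  case (side i)
  then show ?case by (auto simp: crosses_iff)
next
  case (join i k S j T)
  have lt: "i < k" "k < j" using join.hyps triangulation_less by blast+
  have ed: "\<exists>p q. g = {p, q} \<and> i \<le> p \<and> p < q \<and> q \<le> j \<and>
      (g \<in> S \<longrightarrow> q \<le> k) \<and> (g \<in> T \<longrightarrow> k \<le> p)"
    if g: "g \<in> insert {i, j} (S \<union> T)" for g
  proof -
    consider "g = {i, j}" | "g \<in> S" | "g \<in> T" using g by blast
    then show ?thesis
    proof cases
      case 1
      then show ?thesis
        using triangulation_disjoint[OF join.hyps(1,2)] lt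
        by (intro exI[of _ i] exI[of _ j]) auto
    next
      case 2
      then obtain p q where "g = {p, q}" "i \<le> p" "p < q" "q \<le> k"
        using triangulation_edges[OF join.hyps(1)] by blast
      moreover have "g \<notin> T" using 2 triangulation_disjoint[OF join.hyps(1,2)] by blast
      ultimately show ?thesis using lt by (intro exI[of _ p] exI[of _ q]) auto
    next
      case 3
      then obtain p q where "g = {p, q}" "k \<le> p" "p < q" "q \<le> j"
        using triangulation_edges[OF join.hyps(2)] by blast
      moreover have "g \<notin> S" using 3 triangulation_disjoint[OF join.hyps(1,2)] by blast
      ultimately show ?thesis using lt by (intro exI[of _ p] exI[of _ q]) auto
    qed
  qed
  show ?case
  proof (cases "(e \<in> S \<and> f \<in> S) \<or> (e \<in> T \<and> f \<in> T)")
    case True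
    then show ?thesis using join.IH by blast
  next
    case False
    obtain p q where pq: "e = {p, q}" "i \<le> p" "p < q" "q \<le> j"
      "e \<in> S \<Longrightarrow> q \<le> k" "e \<in> T \<Longrightarrow> k \<le> p" using ed[OF join.prems(1)] by blast
    obtain r s where rs: "f = {r, s}" "i \<le> r" "r < s" "s \<le> j"
      "f \<in> S \<Longrightarrow> s \<le> k" "f \<in> T \<Longrightarrow> k \<le> r" using ed[OF join.prems(2)] by blast
    consider "{p, q} = {i, j}" | "{r, s} = {i, j}" | "e \<in> S" "f \<in> T" | "e \<in> T" "f \<in> S"
      using False join.prems pq(1) rs(1) by blast
    then have "\<not> crosses {p, q} {r, s}"
      unfolding crosses_iff[OF pq(3) rs(3)] using pq rs lt
      by cases (auto simp: doubleton_eq_iff)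
    then show ?thesis using pq rs by simp
  qed
qed

text \<open>A missing edge inside one half is covered by induction. One that passes over
  \<open>k\<close> crosses \<open>{i, k}\<close> if \<open>i < p\<close> and \<open>{k, j}\<close>
  if \<open>q < j\<close>; both fail only for the base, which is present.\<close>

lemma triangulation_maximal:
  "triangulation i j F \<Longrightarrow> i \<le> p \<Longrightarrow> p < q \<Longrightarrow> q \<le> j \<Longrightarrow> {p, q} \<notin> F \<Longrightarrow>
    \<exists>f\<in>F. crosses {p, q} f"
proof (induction rule: triangulation.induct)
  case (side i)
  then have "p = i" "q = Suc i" by linarith+
  with side show ?case by blast
next
  case (join i k S j T)
  have lt: "i < k" "k < j" using join.hyps triangulation_less by blast+
  consider "q \<le> k" | "k \<le> p" | "p < k" "k < q" "i < p" | "p < k" "k < q" "q < j"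
    using join.prems by fastforce
  then show ?case
  proof cases
    case 1
    then show ?thesis using join by blast
  next
    case 2
    then show ?thesis using join by blast
  next
    case 3
    then have "crosses {p, q} {i, k}" using lt join.prems by (subst crosses_iff) auto
    then show ?thesis using triangulation_base[OF join.hyps(1)] by blast
  next
    case 4
    then have "crosses {p, q} {k, j}" using lt join.prems by (subst crosses_iff) auto
    then show ?thesis using triangulation_base[OF join.hyps(2)] by blast
  qed
qed

text \<open>The base \<open>{0, n - 1}\<close> is itself a side of the cycle, so the triangulation
  fills the whole polygon.\<close>

lemma triangulation_maximal_outerplanar:
  assumes "triangulation 0 (n - 1) F" "n \<ge> 2"
  shows "maximal_outerplanar n F"
proof -
  have "cycle_edges n \<subseteq> F"
  proof
    fix e assume "e \<in> cycle_edges n"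
    then show "e \<in> F" using assms(2)
      by (rule cycle_edges_cases)
        (use triangulation_sides[OF assms(1)] triangulation_base[OF assms(1)] in auto)
  qed
  moreover have "F \<subseteq> all_edges n"
  proof
    fix e assume "e \<in> F"
    then obtain p q where "e = {p, q}" "p < q" "q \<le> n - 1"
      using triangulation_edges[OF assms(1)] by blast
    then show "e \<in> all_edges n" using assms(2)
      unfolding all_edges_def by (intro CollectI exI[of _ p] exI[of _ q]) auto
  qed
  moreover have "E' = F" if E': "outerplane n E'" "F \<subseteq> E'" for E'
  proof (rule ccontr)
    assume "E' \<noteq> F"
    then obtain e where e: "e \<in> E'" "e \<notin> F" using E' by blast
    then have "e \<in> all_edges n" using E' by (auto simp: outerplane_def)
    then obtain p q where pq: "e = {p, q}" "p < q" "q < n"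
      unfolding all_edges_def by (auto, metis insert_commute linorder_neqE_nat)
    then obtain f where "f \<in> F" "crosses e f"
      using triangulation_maximal[OF assms(1), of p q] e by fastforce
    then show False using E' e by (auto simp: outerplane_def)
  qed
  ultimately show ?thesis
    using triangulation_not_crosses[OF assms(1)]
    by (auto simp: maximal_outerplanar_def outerplane_def)
qed

section \<open>Chord lengths as external path lengths\<close>

lemma TCL_Un:
  assumes "finite S" "finite T" "S \<inter> T = {}"
  shows "TCL n (S \<union> T) = TCL n S + TCL n T"
proof -
  have "S \<union> T - cycle_edges n = (S - cycle_edges n) \<union> (T - cycle_edges n)" by blast
  then show ?thesis using assms unfolding TCL_def
    by (simp, subst sum.union_disjoint) auto
qed

lemma TCL_insert:
  assumes "finite S" "e \<notin> S" "e \<notin> cycle_edges n"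
  shows "TCL n (insert e S) = TCL n S + chord_length n e"
proof -
  have "insert e S - cycle_edges n = insert e (S - cycle_edges n)" using assms by blast
  then show ?thesis using assms by (simp add: TCL_def)
qed

text \<open>Because of \<open>2 * m \<le> n\<close>, a chord over \<open>m\<close> consecutive sides
  has length \<open>m\<close>, which is what a node with \<open>m\<close> leaves contributes. The
  bound \<open>i + m < n\<close> keeps the tree from wrapping past vertex 0.\<close>

lemma triangulation_of_ext_path:
  "ext_path m x \<Longrightarrow> 2 * m \<le> n \<Longrightarrow> i + m < n \<Longrightarrow> \<exists>F. triangulation i (i + m) F \<and> TCL n F = x"
proof (induction arbitrary: i rule: ext_path.induct)
  case leaf
  then have "{i, Suc i} \<in> cycle_edges n" by (subst cycle_edges_iff) auto
  then have "TCL n {{i, Suc i}} = 0" by (simp add: TCL_def)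
  then show ?case using triangulation.side[of i] by auto
next
  case (node a x b y)
  have pos: "1 \<le> a" "1 \<le> b" using node ext_path_pos by blast+
  obtain S where S: "triangulation i (i + a) S" "TCL n S = x"
    using node.IH(1)[of i] node.prems by auto
  obtain T where T: "triangulation (i + a) (i + (a + b)) T" "TCL n T = y"
    using node.IH(2)[of "i + a"] node.prems by (auto simp: add.assoc)
  let ?e = "{i, i + (a + b)}"
  have "?e \<notin> cycle_edges n" using pos node.prems by (subst cycle_edges_iff) auto
  moreover have "chord_length n ?e = a + b" using node.prems by (subst chord_length_eq) auto
  ultimately have "TCL n (insert ?e (S \<union> T)) = a + b + x + y"
    using triangulation_disjoint[OF S(1) T(1)] S(2) T(2)
      triangulation_finite[OF S(1)] triangulation_finite[OF T(1)]
    by (subst TCL_insert) (auto simp: TCL_Un)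
  then show ?case using triangulation.join[OF S(1) T(1)] by blast
qed

text \<open>The third tree spans the side from \<open>s\<close> through \<open>n - 1\<close> back to \<open>0\<close>. It is unfolded along
  the branch that leads to the side from \<open>n - 1\<close> to \<open>0\<close>: a node on this branch cuts off the same
  chord \<open>{0, s}\<close> as the triangulation of \<open>0, \<dots>, s\<close> built so far.\<close>

lemma triangulation_complete:
  "ext_path c x \<Longrightarrow> triangulation 0 s F \<Longrightarrow> 2 \<le> s \<Longrightarrow> s + c = n \<Longrightarrow> 2 * c \<le> n \<Longrightarrow>
    \<exists>F'. triangulation 0 (n - 1) F' \<and> TCL n F' = TCL n (F - {{0, s}}) + x"
proof (induction arbitrary: s F rule: ext_path.induct)
  case leaf
  \<comment> \<open>At the end the base is the cycle side \<open>{0, n - 1}\<close>, so removing it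
    does not change the sum.\<close>
  then have "{0, s} \<in> cycle_edges n" by (subst cycle_edges_iff) auto
  then have "F - {{0, s}} - cycle_edges n = F - cycle_edges n" by blast
  then have "TCL n F = TCL n (F - {{0, s}})" by (simp add: TCL_def)
  moreover have "s = n - 1" using leaf by simp
  ultimately show ?case using leaf by auto
next
  case (node a x b y)
  have pos: "1 \<le> a" "1 \<le> b" using node ext_path_pos by blast+
  \<comment> \<open>The first subtree is laid out on the sides following \<open>s\<close>. The
    second is left to the induction, with \<open>{0, s + a}\<close> as the new base.\<close>
  obtain H where H: "triangulation s (s + a) H" "TCL n H = x"
    using triangulation_of_ext_path[OF node.hyps(1), of n s] node.prems pos by auto
  let ?e = "{0, s}"
  \<comment> \<open>The chord \<open>{0, s}\<close>, left out of the sum in the claim, pays for the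
    root: the \<open>a + b\<close> sides beyond \<open>s\<close> are at most half of the
    cycle.\<close>
  have "F = insert ?e (F - {?e})" using triangulation_base[OF node.prems(1)] by blast
  moreover have "?e \<notin> cycle_edges n" using pos node.prems by (subst cycle_edges_iff) auto
  moreover have "chord_length n ?e = a + b" using pos node.prems by (subst chord_length_eq) auto
  ultimately have F: "TCL n F = TCL n (F - {?e}) + (a + b)"
    using TCL_insert[of "F - {?e}" ?e n] triangulation_finite[OF node.prems(1)] by simp
  let ?G = "insert {0, s + a} (F \<union> H)"
  have "?G - {{0, s + a}} = F \<union> H" using triangulation_disjoint[OF node.prems(1) H(1)] by blast
  then have "TCL n (?G - {{0, s + a}}) = TCL n F + x"
    using triangulation_disjoint[OF node.prems(1) H(1)] H(2)
      triangulation_finite[OF node.prems(1)] triangulation_finite[OF H(1)]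
    by (simp add: TCL_Un)
  moreover obtain F' where "triangulation 0 (n - 1) F'"
      "TCL n F' = TCL n (?G - {{0, s + a}}) + y"
    using node.IH(2)[OF triangulation.join[OF node.prems(1) H(1)]] node.prems
    by (auto simp: add.assoc)
  ultimately show ?case using F by auto
qed

lemma central_realized:
  assumes "central n v"
  shows "\<exists>E. maximal_outerplanar n E \<and> TCL n E = v"
proof -
  from assms obtain a b c x y z where h: "ext_path a x" "ext_path b y" "ext_path c z"
    "a + b + c = n" "2 * a \<le> n" "2 * b \<le> n" "2 * c \<le> n" "v = x + y + z"
    unfolding central_def by blast
  have pos: "1 \<le> a" "1 \<le> b" "1 \<le> c" using h ext_path_pos by blast+
  obtain S where S: "triangulation 0 a S" "TCL n S = x"
    using triangulation_of_ext_path[OF h(1), of n 0] h pos by auto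
  obtain T where T: "triangulation a (a + b) T" "TCL n T = y"
    using triangulation_of_ext_path[OF h(2), of n a] h pos by auto
  \<comment> \<open>The central triangle has the vertices \<open>0\<close>, \<open>a\<close> and
    \<open>a + b\<close>. Its side \<open>{0, a + b}\<close> is not counted yet, since it belongs to
    the root of the third tree.\<close>
  let ?G = "insert {0, a + b} (S \<union> T)"
  have "?G - {{0, a + b}} = S \<union> T" using triangulation_disjoint[OF S(1) T(1)] by blast
  then have "TCL n (?G - {{0, a + b}}) = x + y"
    using triangulation_disjoint[OF S(1) T(1)] S(2) T(2)
      triangulation_finite[OF S(1)] triangulation_finite[OF T(1)]
    by (simp add: TCL_Un)
  then obtain F where "triangulation 0 (n - 1) F" "TCL n F = v"
    using triangulation_complete[OF h(3) triangulation.join[OF S(1) T(1)], of n] h pos by auto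
  then show ?thesis using triangulation_maximal_outerplanar[of n F] h pos by auto
qed

section \<open>The shell graph\<close>

lemma sum_min_eq_shell_value: "n \<ge> 3 \<Longrightarrow> (\<Sum>j = 2..n - 2. min j (n - j)) = shell_value n"
proof -
  assume n: "n \<ge> 3"
  let ?A = "{2..n div 2} \<inter> {..n - 2}" and ?B = "{n div 2 <.. n - 2}"
  have "{2..n - 2} = ?A \<union> ?B" using n by auto
  then have "(\<Sum>j = 2..n - 2. min j (n - j)) = (\<Sum>j\<in>?A \<union> ?B. min j (n - j))" by simp
  also have "\<dots> = (\<Sum>j\<in>?A. min j (n - j)) + (\<Sum>j\<in>?B. min j (n - j))"
    by (rule sum.union_disjoint) auto
  also have "?A = {2..n div 2}" using n by auto
  also have "(\<Sum>j = 2..n div 2. min j (n - j)) = caterpillar (n div 2)"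
    unfolding caterpillar_def by (rule sum.cong) auto
  \<comment> \<open>Past the middle the other arc is the shorter one, so \<open>j\<close> is
    reflected to \<open>n - j\<close>.\<close>
  also have "(\<Sum>j\<in>?B. min j (n - j)) = caterpillar ((n - 1) div 2)"
    unfolding caterpillar_def
    by (rule sum.reindex_bij_witness[of _ "\<lambda>j. n - j" "\<lambda>j. n - j"]) auto
  finally show ?thesis by (simp add: shell_value_def)
qed

lemma TCL_shell_graph:
  assumes "n \<ge> 5"
  shows "TCL n (shell_graph n) = shell_value n"
proof -
  have notin: "{0, j} \<notin> cycle_edges n" if "2 \<le> j" "j \<le> n - 2" for j
    using that assms by (subst cycle_edges_iff) auto
  have "shell_graph n - cycle_edges n = (\<lambda>j. {0, j}) ` {2..n - 2}"
    using notin by (auto simp: shell_graph_def)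
  moreover have "inj_on (\<lambda>j::nat. {0, j}) {2..n - 2}"
    by (auto simp: inj_on_def doubleton_eq_iff)
  ultimately have "TCL n (shell_graph n) = (\<Sum>j = 2..n - 2. chord_length n {0, j})"
    by (simp add: TCL_def sum.reindex)
  also have "\<dots> = (\<Sum>j = 2..n - 2. min j (n - j))"
    using assms by (intro sum.cong refl) (auto simp: chord_length_eq)
  finally show ?thesis using assms sum_min_eq_shell_value[of n] by simp
qed

section \<open>The greedy graph\<close>

lemma crosses_iff_min_max:
  assumes "p \<noteq> q" "r \<noteq> s"
  shows "crosses {p, q} {r, s} \<longleftrightarrow>
    (min p q < min r s \<and> min r s < max p q \<and> max p q < max r s) \<or>
    (min r s < min p q \<and> min p q < max r s \<and> max r s < max p q)"
proof -
  have "{min x y, max x y} = {x, y}" for x y :: nat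
    by (auto simp: min_def max_def)
  moreover have "min p q < max p q" "min r s < max r s" using assms by auto
  ultimately show ?thesis using crosses_iff[of "min p q" "max p q" "min r s" "max r s"] by metis
qed

lemma mod_add_diff: "x \<le> v \<Longrightarrow> (x mod n + (v - x)) mod n = v mod (n::nat)"
  by (metis le_add_diff_inverse mod_add_left_eq)

lemma mod_eq_imp_eq:
  fixes x :: nat
  assumes "u mod n = v mod n" "x \<le> u" "u < x + n" "x \<le> v" "v < x + n"
  shows "u = v"
proof -
  have "u = v" if "u \<le> v" "u mod n = v mod n" "x \<le> u" "v < x + n" for u v
  proof -
    have "n dvd v - u" using that mod_eq_dvd_iff_nat[of u v n] by simp
    moreover have "v - u < n" using that by linarith
    ultimately show ?thesis using that(1) by (auto dest: dvd_imp_le)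
  qed
  then show ?thesis using assms by (metis nat_le_linear)
qed

text \<open>Over one turn starting at \<open>x\<close>, residues are positions shifted by a common
  offset, with a single jump by \<open>n\<close>. This reduces the crossing lemmas below to linear
  arithmetic.\<close>

lemma mod_unroll:
  fixes x :: nat
  assumes "x \<le> v" "v \<le> x + n" "n > 0"
  shows "(v < x - x mod n + n \<and> v mod n + (x - x mod n) = v) \<or>
    (x - x mod n + n \<le> v \<and> v mod n + (x - x mod n) + n = v)"
proof -
  have r: "x mod n < n" "x mod n \<le> x" using assms by auto
  have "v mod n = (x mod n + (v - x)) mod n" using mod_add_diff assms by metis
  then show ?thesis using mod_add_cases[of "x mod n" n "v - x"] r assms by linarith
qed

lemma crosses_mod:
  fixes x :: nat
  assumes "x < y" "y < z" "z < w" "w < x + n"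
  shows "crosses {y mod n, w mod n} {x mod n, z mod n}"
proof -
  define q where "q = x - x mod n"
  define X Y Z W where "X = x mod n" "Y = y mod n" "Z = z mod n" "W = w mod n"
  have x: "X + q = x" "X < n" using assms by (simp_all add: q_def X_Y_Z_W_def)
  have y: "(y < q + n \<and> Y + q = y) \<or> (q + n \<le> y \<and> Y + q + n = y)"
    and z: "(z < q + n \<and> Z + q = z) \<or> (q + n \<le> z \<and> Z + q + n = z)"
    and w: "(w < q + n \<and> W + q = w) \<or> (q + n \<le> w \<and> W + q + n = w)"
    using mod_unroll[of x _ n] assms unfolding q_def X_Y_Z_W_def by auto
  have "Y \<noteq> W" "X \<noteq> Z" using x y z w assms by linarith+
  \<comment> \<open>Taking residues only rotates the cyclic order, so one of the four rotations is
    increasing.\<close>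
  moreover have "(X < Y \<and> Y < Z \<and> Z < W) \<or>
      (W < X \<and> X < Y \<and> Y < Z) \<or> (Z < W \<and> W < X \<and> X < Y) \<or> (Y < Z \<and> Z < W \<and> W < X)"
    using x y z w assms by linarith
  ultimately have "crosses {Y, W} {X, Z}" by (subst crosses_iff_min_max) auto
  then show ?thesis by (simp add: X_Y_Z_W_def)
qed

lemma not_crosses_mod:
  fixes x :: nat
  assumes "x < z" "z \<le> u" "u < v" "v \<le> x + n"
  shows "\<not> crosses {u mod n, v mod n} {x mod n, z mod n}"
proof -
  define q where "q = x - x mod n"
  define X Z U V where "X = x mod n" "Z = z mod n" "U = u mod n" "V = v mod n"
  have x: "X + q = x" "X < n" using assms by (simp_all add: q_def X_Z_U_V_def)
  have z: "(z < q + n \<and> Z + q = z) \<or> (q + n \<le> z \<and> Z + q + n = z)"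
    and u: "(u < q + n \<and> U + q = u) \<or> (q + n \<le> u \<and> U + q + n = u)"
    and v: "(v < q + n \<and> V + q = v) \<or> (q + n \<le> v \<and> V + q + n = v)"
    using mod_unroll[of x _ n] assms unfolding q_def X_Z_U_V_def by auto
  have "U \<noteq> V" "X \<noteq> Z" using x z u v assms by linarith+
  moreover have "(X < Z \<and> Z \<le> U \<and> U < V) \<or> (V \<le> X \<and> X < Z \<and> Z \<le> U) \<or>
      (U < V \<and> V \<le> X \<and> X < Z) \<or> (Z \<le> U \<and> U < V \<and> V \<le> X)"
    using x z u v assms by linarith
  ultimately have "\<not> crosses {U, V} {X, Z}" by (subst crosses_iff_min_max) auto
  then show ?thesis by (simp add: X_Z_U_V_def)
qed

text \<open>The vertices visited by the greedy construction, unrolled along the cycle. After \<open>t\<close> chords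
  the construction stands at \<open>greedy_pos n (2 * t)\<close>, and the polygon that is not yet triangulated
  has the vertices \<open>greedy_pos n (2 * t), \<dots>, greedy_pos n (n + t - 1)\<close> modulo \<open>n\<close>. The values
  for \<open>i \<ge> 2 * n\<close> are irrelevant.\<close>

fun greedy_pos :: "nat \<Rightarrow> nat \<Rightarrow> nat" where
  "greedy_pos n i = (if i \<le> n \<or> 2 * n \<le> i then i else greedy_pos n (2 * (i - n)) + n)"

declare greedy_pos.simps [simp del]

lemma greedy_pos_le: "i \<le> n \<Longrightarrow> greedy_pos n i = i"
  by (simp add: greedy_pos.simps)

text \<open>The next chord joins the indices \<open>2 * t\<close> and \<open>2 * t + 2\<close> and
  cuts off the vertex between them. Its starting vertex stays in the polygon and moves from the
  front to the back, one turn further on.\<close>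

lemma greedy_pos_add: "t < n \<Longrightarrow> greedy_pos n (n + t) = greedy_pos n (2 * t) + n"
  by (cases "t = 0") (simp_all add: greedy_pos.simps[of n "n + t"] greedy_pos_le)

lemma greedy_pos_Suc: "Suc i < 2 * n \<Longrightarrow> greedy_pos n i < greedy_pos n (Suc i)"
proof (induction i rule: less_induct)
  case (less i)
  show ?case
  proof (cases "i < n")
    case True
    then show ?thesis by (simp add: greedy_pos_le)
  next
    case False
    define t where "t = i - n"
    have i: "i = n + t" and t: "Suc t < n" using False less.prems by (auto simp: t_def)
    have "greedy_pos n (2 * t) < greedy_pos n (Suc (2 * t))"
      "greedy_pos n (Suc (2 * t)) < greedy_pos n (Suc (Suc (2 * t)))"
      using i t by (auto intro!: less.IH)
    then show ?thesis
      using greedy_pos_add[of t n] greedy_pos_add[of "Suc t" n] i t by simp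
  qed
qed

lemma greedy_pos_less: "i < j \<Longrightarrow> j < 2 * n \<Longrightarrow> greedy_pos n i < greedy_pos n j"
proof (induction j)
  case (Suc j)
  then show ?case using greedy_pos_Suc[of j n] by (cases "i = j") auto
qed simp

text \<open>The gaps between positions never decrease, so the two front ones are always smallest, as
  Huffman's algorithm requires. From index \<open>n\<close> on, each gap is the sum of two
  consecutive earlier ones and the next gap is the sum of the following two, so the order is
  inherited.\<close>

lemma greedy_pos_convex:
  "i + 2 < 2 * n \<Longrightarrow>
    2 * greedy_pos n (Suc i) \<le> greedy_pos n i + greedy_pos n (i + 2)"
proof (induction i rule: less_induct)
  case (less i)
  consider "i + 2 \<le> n" | "i + 1 = n" | "n \<le> i" by linarith
  then show ?case
  proof cases
    case 1
    then show ?thesis by (simp add: greedy_pos_le)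
  next
    case 2
    then have "n \<ge> 2" "i + 2 = n + 1" using less.prems by auto
    then show ?thesis using 2 greedy_pos_add[of 1 n] by (simp add: greedy_pos_le)
  next
    case 3
    define t where "t = i - n"
    have i: "i = n + t" and t: "t + 2 < n" using 3 less.prems by (auto simp: t_def)
    have "2 * greedy_pos n (Suc (2 * t)) \<le> greedy_pos n (2 * t) + greedy_pos n (2 * t + 2)"
      "2 * greedy_pos n (Suc (2 * t + 1)) \<le> greedy_pos n (2 * t + 1) + greedy_pos n (2 * t + 1 + 2)"
      "2 * greedy_pos n (Suc (2 * t + 2)) \<le> greedy_pos n (2 * t + 2) + greedy_pos n (2 * t + 2 + 2)"
      by (rule less.IH; use i t in simp)+
    then have "2 * greedy_pos n (2 * t + 2) \<le> greedy_pos n (2 * t) + greedy_pos n (2 * t + 4)"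
      by (simp add: numeral_eq_Suc)
    then show ?thesis
      using greedy_pos_add[of t n] greedy_pos_add[of "Suc t" n] greedy_pos_add[of "t + 2" n] i t
      by (simp add: numeral_eq_Suc)
  qed
qed

text \<open>By convexity the two front gaps together are at most the next two, and all four fit into
  one turn while the open polygon has at least four sides.\<close>

lemma greedy_pos_chord:
  assumes "t + 4 \<le> n"
  shows "2 * (greedy_pos n (2 * t + 2) - greedy_pos n (2 * t)) \<le> n"
proof -
  have c: "2 * greedy_pos n (Suc (2 * t)) \<le> greedy_pos n (2 * t) + greedy_pos n (2 * t + 2)"
    "2 * greedy_pos n (Suc (2 * t + 1)) \<le> greedy_pos n (2 * t + 1) + greedy_pos n (2 * t + 1 + 2)"
    "2 * greedy_pos n (Suc (2 * t + 2)) \<le> greedy_pos n (2 * t + 2) + greedy_pos n (2 * t + 2 + 2)"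
    using assms by (intro greedy_pos_convex; simp)+
  have "greedy_pos n (2 * t + 4) \<le> greedy_pos n (n + t)"
    using assms greedy_pos_less[of "2 * t + 4" "n + t" n] by (cases "2 * t + 4 = n + t") auto
  then show ?thesis
    using c greedy_pos_add[of t n] assms by (simp add: numeral_eq_Suc)
qed

text \<open>The diagonals of the polygon that is not yet triangulated; the excluded pair of indices
  is its closing side.\<close>

definition open_chord :: "nat \<Rightarrow> nat \<Rightarrow> nat set \<Rightarrow> bool" where
  "open_chord n t e \<longleftrightarrow> (\<exists>i j. 2 * t \<le> i \<and> i + 2 \<le> j \<and> j < n + t \<and>
     \<not> (i = 2 * t \<and> Suc j = n + t) \<and> e = {greedy_pos n i mod n, greedy_pos n j mod n})"

lemma possible_chord_cycle:
  assumes "n \<ge> 4"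
  shows "possible_chord n (cycle_edges n) e \<longleftrightarrow> open_chord n 0 e"
proof
  assume p: "possible_chord n (cycle_edges n) e"
  then obtain u v where uv: "e = {u, v}" "u < v" "v < n"
    unfolding possible_chord_def all_edges_def by (auto, metis insert_commute linorder_neqE_nat)
  then have "v \<noteq> Suc u \<and> \<not> (u = 0 \<and> v = n - 1)"
    using p cycle_edges_iff[of u v n] by (auto simp: possible_chord_def)
  then show "open_chord n 0 e"
    unfolding open_chord_def using uv
    by (intro exI[of _ u] exI[of _ v]) (auto simp: greedy_pos_le)
next
  assume "open_chord n 0 e"
  then obtain i j where ij: "i + 2 \<le> j" "j < n" "\<not> (i = 0 \<and> Suc j = n)" "e = {i, j}"
    unfolding open_chord_def by (auto simp: greedy_pos_le)
  have "e \<in> all_edges n" using ij unfolding all_edges_def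
    by (intro CollectI exI[of _ i] exI[of _ j]) auto
  moreover have "e \<notin> cycle_edges n" using ij cycle_edges_iff[of i j n] by auto
  moreover have "\<not> crosses e f" if "f \<in> cycle_edges n" for f
  proof -
    have "n \<ge> 2" using assms by simp
    with that show ?thesis
      by (rule cycle_edges_cases) (use ij assms in \<open>auto simp: crosses_iff\<close>)
  qed
  ultimately show "possible_chord n (cycle_edges n) e" by (auto simp: possible_chord_def)
qed

text \<open>Drawing \<open>f\<close> cuts off the vertex with index \<open>2 * t + 1\<close>, and
  the diagonals ending there are those that cross \<open>f\<close>. The others except
  \<open>f\<close> survive; those from \<open>2 * t\<close> reappear with the index
  \<open>n + t\<close>.\<close>

lemma open_chord_step:
  assumes t: "t + 4 \<le> n"
    and f: "f = {greedy_pos n (2 * t) mod n, greedy_pos n (2 * t + 2) mod n}"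
  shows "open_chord n (Suc t) e \<longleftrightarrow> open_chord n t e \<and> e \<noteq> f \<and> \<not> crosses e f"
proof
  let ?p = "greedy_pos n"
  have wrap: "?p (n + t) = ?p (2 * t) + n" using t by (simp add: greedy_pos_add)
  have less: "?p i < ?p j" if "i < j" "j \<le> n + t" for i j
    using that t by (intro greedy_pos_less) auto
  {
    assume "open_chord n (Suc t) e"
    then obtain i j where ij: "2 * t + 2 \<le> i" "i + 2 \<le> j" "j \<le> n + t"
      "\<not> (i = 2 * t + 2 \<and> j = n + t)" "e = {?p i mod n, ?p j mod n}"
      unfolding open_chord_def by auto
    have le: "?p (2 * t + 2) \<le> ?p i" using ij less[of "2 * t + 2" i] by (cases "2 * t + 2 = i") auto
    have jle: "?p j \<le> ?p (2 * t) + n" using ij less[of j "n + t"] wrap by (cases "j = n + t") auto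
    have lt: "?p (2 * t) < ?p (2 * t + 2)" "?p i < ?p j" using ij t less by auto
    have "\<not> crosses e f" using not_crosses_mod[OF lt(1) le lt(2) jle] ij f by simp
    moreover have "open_chord n t e \<and> e \<noteq> f"
    proof (cases "j = n + t")
      case True
      then have "open_chord n t e"
        unfolding open_chord_def using ij wrap
        by (intro exI[of _ "2 * t"] exI[of _ i]) (auto simp: insert_commute)
      moreover have "?p i mod n \<noteq> ?p (2 * t) mod n"
        using mod_eq_imp_eq[of "?p i" n "?p (2 * t)" "?p (2 * t)"] le lt jle by linarith
      moreover have "?p (2 * t + 2) < ?p i" using True ij less[of "2 * t + 2" i] by auto
      then have "?p i mod n \<noteq> ?p (2 * t + 2) mod n"
        using mod_eq_imp_eq[of "?p i" n "?p (2 * t + 2)" "?p (2 * t)"] lt jle by linarith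
      ultimately show ?thesis using ij f by auto
    next
      case False
      then have "open_chord n t e"
        unfolding open_chord_def using ij
        by (intro exI[of _ i] exI[of _ j]) auto
      moreover have "?p j < ?p (2 * t) + n" using False ij less[of j "n + t"] wrap by auto
      then have "?p (2 * t) mod n \<noteq> ?p i mod n" "?p (2 * t) mod n \<noteq> ?p j mod n"
        using mod_eq_imp_eq[of "?p (2 * t)" n "?p i" "?p (2 * t)"]
          mod_eq_imp_eq[of "?p (2 * t)" n "?p j" "?p (2 * t)"] le lt by linarith+
      ultimately show ?thesis using ij f by auto
    qed
    ultimately show "open_chord n t e \<and> e \<noteq> f \<and> \<not> crosses e f" by blast
  next
    assume e: "open_chord n t e \<and> e \<noteq> f \<and> \<not> crosses e f"
    then obtain i j where ij: "2 * t \<le> i" "i + 2 \<le> j" "j < n + t"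
      "\<not> (i = 2 * t \<and> Suc j = n + t)" "e = {?p i mod n, ?p j mod n}"
      unfolding open_chord_def by blast
    consider "i = 2 * t" | "i = 2 * t + 1" | "2 * t + 2 \<le> i" using ij(1) by linarith
    then show "open_chord n (Suc t) e"
    proof cases
      case 1
      \<comment> \<open>The front vertex now has index \<open>n + t\<close>, so the new pair of
        indices is \<open>j\<close> and \<open>n + t\<close>. As \<open>e\<close> differs from
        \<open>f\<close>, it is not the new closing side.\<close>
      then have "j \<noteq> 2 * t + 2" using e ij f by auto
      then show ?thesis
        unfolding open_chord_def using 1 ij wrap
        by (intro exI[of _ j] exI[of _ "n + t"]) (auto simp: insert_commute)
    next
      case 2
      have "?p (2 * t) < ?p i" "?p i < ?p (2 * t + 2)" "?p (2 * t + 2) < ?p j"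
        "?p j < ?p (2 * t) + n"
        using 2 ij less wrap[symmetric] by auto
      then have "crosses e f" using crosses_mod ij f by simp
      then show ?thesis using e by blast
    next
      case 3
      then show ?thesis
        unfolding open_chord_def using ij
        by (intro exI[of _ i] exI[of _ j]) auto
    qed
  }
qed

text \<open>Later positions lie further clockwise, so the nearest admissible end is two indices
  ahead. It is at most half a turn away, hence its clockwise distance is the chord length.\<close>

lemma greedy_length_eq:
  assumes t: "t + 4 \<le> n" and possible: "\<And>e. possible_chord n E e \<longleftrightarrow> open_chord n t e"
  shows "greedy_length n E (greedy_pos n (2 * t) mod n) =
    greedy_pos n (2 * t + 2) - greedy_pos n (2 * t)"
  unfolding greedy_length_def
proof (rule Least_equality)
  let ?p = "greedy_pos n"
  let ?a = "?p (2 * t) mod n"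
  let ?D = "?p (2 * t + 2) - ?p (2 * t)"
  have wrap: "?p (n + t) = ?p (2 * t) + n" using t by (simp add: greedy_pos_add)
  have less: "?p i < ?p j" if "i < j" "j \<le> n + t" for i j
    using that t by (intro greedy_pos_less) auto
  have "?p (2 * t) < ?p (2 * t + 2)" using t less by simp
  then have "(?a + ?D) mod n = ?p (2 * t + 2) mod n" by (intro mod_add_diff) simp
  moreover have "open_chord n t {?a, ?p (2 * t + 2) mod n}"
    unfolding open_chord_def using t
    by (intro exI[of _ "2 * t"] exI[of _ "2 * t + 2"]) auto
  moreover have "chord_length n {?a, (?a + ?D) mod n} = ?D"
    using t greedy_pos_chord[OF t] by (intro chord_length_clockwise) auto
  ultimately show "possible_chord n E {?a, (?a + ?D) mod n} \<and>
      chord_length n {?a, (?a + ?D) mod n} = ?D"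
    using possible by simp
  fix d
  assume "possible_chord n E {?a, (?a + d) mod n} \<and> chord_length n {?a, (?a + d) mod n} = d"
  then have "open_chord n t {?a, (?p (2 * t) + d) mod n}"
    using possible by (simp add: mod_add_left_eq)
  then obtain i j where ij: "2 * t \<le> i" "i + 2 \<le> j" "j < n + t"
      "{?a, (?p (2 * t) + d) mod n} = {?p i mod n, ?p j mod n}"
    unfolding open_chord_def by blast
  have i: "?p (2 * t) \<le> ?p i" using less[of "2 * t" i] ij by (cases "i = 2 * t") auto
  have j: "?p i < ?p j" "?p j < ?p (2 * t) + n" using less ij wrap[symmetric] by auto
  \<comment> \<open>So \<open>?a\<close> is the endpoint with index \<open>i\<close>, and
    \<open>d\<close> steps lead to the one with index \<open>j\<close>, up to full turns.\<close>
  have "?p j mod n \<noteq> ?a"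
    using mod_eq_imp_eq[of "?p j" n "?p (2 * t)" "?p (2 * t)"] i j by linarith
  then have *: "(?p (2 * t) + d) mod n = ?p j mod n" using ij(4) by (auto simp: doubleton_eq_iff)
  show "?D \<le> d"
  proof (cases "d < n")
    case True
    then have "?p (2 * t) + d = ?p j"
      using mod_eq_imp_eq[OF *, of "?p (2 * t)"] i j by linarith
    moreover have "?p (2 * t + 2) \<le> ?p j"
      using less[of "2 * t + 2" j] ij by (cases "2 * t + 2 = j") auto
    ultimately show ?thesis by linarith
  next
    case False
    then show ?thesis using greedy_pos_chord[OF t] by linarith
  qed
qed

section \<open>The greedy construction as Huffman's algorithm\<close>

definition greedy_gap :: "nat \<Rightarrow> nat \<Rightarrow> nat" where
  "greedy_gap n i = greedy_pos n (Suc i) - greedy_pos n i"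

text \<open>Merging the two front gaps into a new gap at the back of the queue is a step of Huffman's
  algorithm: \<open>w i\<close> is the total length of the chords that gap \<open>i\<close> has been merged from.\<close>

definition greedy_invariant :: "nat \<Rightarrow> nat \<Rightarrow> nat set set \<Rightarrow> bool" where
  "greedy_invariant n t E \<longleftrightarrow> finite E \<and> cycle_edges n \<subseteq> E \<and>
     (\<forall>e. possible_chord n E e \<longleftrightarrow> open_chord n t e) \<and>
     (\<exists>w. (\<forall>i < n + t. ext_path (greedy_gap n i) (w i)) \<and> TCL n E = (\<Sum>i = 2 * t..<n + t. w i))"

lemma greedy_invariant_0:
  assumes "n \<ge> 4"
  shows "greedy_invariant n 0 (cycle_edges n)"
proof -
  have "finite (cycle_edges n)" by (simp add: cycle_edges_def)
  moreover have "ext_path (greedy_gap n i) 0" if "i < n" for i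
    using that ext_path.leaf by (simp add: greedy_gap_def greedy_pos_le)
  moreover have "TCL n (cycle_edges n) = 0" by (simp add: TCL_def)
  ultimately show ?thesis
    using possible_chord_cycle[OF assms]
    unfolding greedy_invariant_def by (auto intro!: exI[of _ "\<lambda>_. 0"])
qed

lemma greedy_invariant_Suc:
  assumes t: "t + 4 \<le> n" and inv: "greedy_invariant n t E"
    and f: "f = {greedy_pos n (2 * t) mod n, greedy_pos n (2 * t + 2) mod n}"
  shows "greedy_invariant n (Suc t) (insert f E)"
proof -
  let ?p = "greedy_pos n"
  from inv have E: "finite E" "cycle_edges n \<subseteq> E"
    "\<And>e. possible_chord n E e \<longleftrightarrow> open_chord n t e" by (auto simp: greedy_invariant_def)
  from inv obtain w where w: "\<And>i. i < n + t \<Longrightarrow> ext_path (greedy_gap n i) (w i)"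
    "TCL n E = (\<Sum>i = 2 * t..<n + t. w i)" by (auto simp: greedy_invariant_def)
  have less: "?p (2 * t) < ?p (Suc (2 * t))" "?p (Suc (2 * t)) < ?p (2 * t + 2)"
    using t greedy_pos_Suc[of "2 * t" n] greedy_pos_Suc[of "Suc (2 * t)" n] by auto
  let ?g = "greedy_gap n"
  have gap: "?g (n + t) = ?p (2 * t + 2) - ?p (2 * t)"
    using t greedy_pos_add[of t n] greedy_pos_add[of "Suc t" n] by (simp add: greedy_gap_def)
  then have gap': "?g (n + t) = ?g (2 * t) + ?g (Suc (2 * t))"
    using less by (simp add: greedy_gap_def)
  \<comment> \<open>The new chord is the root joining the two front trees, and its length is the
    number of leaves below it.\<close>
  define w' where "w' = w(n + t := ?g (n + t) + w (2 * t) + w (Suc (2 * t)))"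
  have "ext_path (?g i) (w' i)" if "i < n + Suc t" for i
  proof (cases "i = n + t")
    case True
    have "ext_path (?g (2 * t)) (w (2 * t))" "ext_path (?g (Suc (2 * t))) (w (Suc (2 * t)))"
      using w(1) t by auto
    from ext_path.node[OF this] show ?thesis using True gap' by (simp add: w'_def)
  next
    case False
    then show ?thesis using that w(1) by (simp add: w'_def)
  qed
  moreover have "TCL n (insert f E) = (\<Sum>i = 2 * Suc t..<n + Suc t. w' i)"
  proof -
    have "open_chord n t f" unfolding open_chord_def f using t
      by (intro exI[of _ "2 * t"] exI[of _ "2 * t + 2"]) auto
    then have "f \<notin> E" using E(3) by (auto simp: possible_chord_def)
    moreover have "chord_length n f = ?g (n + t)"
    proof -
      have "(?p (2 * t) mod n + ?g (n + t)) mod n = ?p (2 * t + 2) mod n"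
        unfolding gap using less by (intro mod_add_diff) simp
      then show ?thesis
        using chord_length_clockwise[of "?p (2 * t) mod n" n "?g (n + t)"] greedy_pos_chord[OF t]
          gap f t by simp
    qed
    ultimately have "TCL n (insert f E) = (\<Sum>i = 2 * t..<n + t. w i) + ?g (n + t)"
      using TCL_insert[of E f n] E w(2) by auto
    also have "(\<Sum>i = 2 * t..<n + t. w i) =
        w (2 * t) + w (Suc (2 * t)) + (\<Sum>i = Suc (Suc (2 * t))..<n + t. w i)"
      using t by (simp add: sum.atLeast_Suc_lessThan)
    also have "(\<Sum>i = Suc (Suc (2 * t))..<n + t. w i) = (\<Sum>i = Suc (Suc (2 * t))..<n + t. w' i)"
      by (rule sum.cong) (auto simp: w'_def)
    also have "w (2 * t) + w (Suc (2 * t)) + (\<Sum>i = Suc (Suc (2 * t))..<n + t. w' i) + ?g (n + t) =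
        (\<Sum>i = 2 * Suc t..<n + Suc t. w' i)"
      using t by (simp add: w'_def)
    finally show ?thesis .
  qed
  moreover have "possible_chord n (insert f E) e \<longleftrightarrow> open_chord n (Suc t) e" for e
    unfolding open_chord_step[OF t f] E(3)[symmetric] by (auto simp: possible_chord_def)
  ultimately show ?thesis using E(1,2) by (auto simp: greedy_invariant_def)
qed

lemma greedy_steps:
  assumes "n \<ge> 4"
  shows "t + 3 \<le> n \<Longrightarrow> \<exists>E. (greedy_step n ^^ t) (0, cycle_edges n) =
    (greedy_pos n (2 * t) mod n, E) \<and> greedy_invariant n t E"
proof (induction t)
  case 0
  then show ?case using greedy_invariant_0[OF assms] by (simp add: greedy_pos_le)
next
  case (Suc t)
  then obtain E where E: "(greedy_step n ^^ t) (0, cycle_edges n) =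
      (greedy_pos n (2 * t) mod n, E)" "greedy_invariant n t E" by auto
  have t: "t + 4 \<le> n" using Suc.prems by simp
  have "greedy_pos n (2 * t) < greedy_pos n (2 * t + 2)"
    using t by (intro greedy_pos_less) auto
  moreover have "greedy_length n E (greedy_pos n (2 * t) mod n) =
      greedy_pos n (2 * t + 2) - greedy_pos n (2 * t)"
    using greedy_length_eq[OF t] E(2) by (auto simp: greedy_invariant_def)
  ultimately have "(greedy_pos n (2 * t) mod n +
      greedy_length n E (greedy_pos n (2 * t) mod n)) mod n = greedy_pos n (2 * t + 2) mod n"
    by (simp only: mod_add_diff less_imp_le)
  then show ?case using E(1) greedy_invariant_Suc[OF t E(2) refl] by (simp add: Let_def)
qed

text \<open>After \<open>n - 3\<close> chords the open polygon is a triangle. Its sides are the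
  three remaining gaps, and it serves as the central triangle.\<close>

lemma central_TCL_greedy_graph:
  assumes "n \<ge> 4"
  shows "central n (TCL n (greedy_graph n))"
proof -
  define m where "m = n - 4"
  have n: "n = m + 4" using assms by (simp add: m_def)
  obtain E where E: "greedy_graph n = E" "greedy_invariant n (Suc m) E"
    using greedy_steps[OF assms, of "Suc m"] n by (auto simp: greedy_graph_def)
  then obtain w where w: "\<And>i. i < n + Suc m \<Longrightarrow> ext_path (greedy_gap n i) (w i)"
    "TCL n E = (\<Sum>i = 2 * Suc m..<n + Suc m. w i)" by (auto simp: greedy_invariant_def)
  let ?p = "greedy_pos n"
  let ?k = "2 * m + 2"
  have sum: "TCL n E = w ?k + w (?k + 1) + w (?k + 2)"
  proof -
    have "{2 * Suc m..<n + Suc m} = {?k, ?k + 1, ?k + 2}" using n by auto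
    then show ?thesis using w(2) by simp
  qed
  have "?p (?k + 3) = ?p ?k + n"
    using greedy_pos_add[of "Suc m" n] n by (simp add: numeral_eq_Suc)
  moreover have "?p (?k + 2) = ?p (2 * m) + n"
    using greedy_pos_add[of m n] n by (simp add: numeral_eq_Suc)
  moreover have "?p ?k < ?p (?k + 1)" "?p (?k + 1) < ?p (?k + 2)" "?p (?k + 2) < ?p (?k + 3)"
    using n by (auto intro: greedy_pos_less)
  moreover have "2 * ?p (?k + 1) \<le> ?p ?k + ?p (?k + 2)"
    "2 * ?p (?k + 2) \<le> ?p (?k + 1) + ?p (?k + 3)"
    using greedy_pos_convex[of ?k n] greedy_pos_convex[of "?k + 1" n] n
    by (simp_all add: numeral_eq_Suc)
  \<comment> \<open>The last and largest gap is the length of the last chord drawn, hence at most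
    half of \<open>n\<close>; the other two are bounded by it through convexity.\<close>
  moreover have "2 * (?p ?k - ?p (2 * m)) \<le> n" using greedy_pos_chord[of m n] n by simp
  moreover have "greedy_gap n ?k = ?p (?k + 1) - ?p ?k"
    "greedy_gap n (?k + 1) = ?p (?k + 2) - ?p (?k + 1)"
    "greedy_gap n (?k + 2) = ?p (?k + 3) - ?p (?k + 2)"
    by (simp_all add: greedy_gap_def numeral_eq_Suc)
  ultimately have g: "greedy_gap n ?k + greedy_gap n (?k + 1) + greedy_gap n (?k + 2) = n"
    "2 * greedy_gap n ?k \<le> n" "2 * greedy_gap n (?k + 1) \<le> n" "2 * greedy_gap n (?k + 2) \<le> n"
    by linarith+
  have "ext_path (greedy_gap n ?k) (w ?k)" "ext_path (greedy_gap n (?k + 1)) (w (?k + 1))"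
    "ext_path (greedy_gap n (?k + 2)) (w (?k + 2))"
    using w(1) n by simp_all
  from centralI[OF this g sum] show ?thesis using E(1) by simp
qed

theorem theorem6:
  fixes n :: nat and l :: int
  assumes "n \<ge> 5"
    and "int (TCL n (greedy_graph n)) \<le> l"
    and "l \<le> int (TCL n (shell_graph n))"
  shows "\<exists>E. maximal_outerplanar n E \<and> int (TCL n E) = l"
proof -
  have "central n (nat l)"
    using central_interval[OF central_TCL_greedy_graph[of n], of "nat l"] TCL_shell_graph[of n] assms
    by simp
  from central_realized[OF this] show ?thesis using assms(2) by auto
qed

end
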